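(* Let $V$ be a real topological vector space and let $q : V \to \mathbb{R}$ be a weak Minkowski norm that is continuous with respect to the topology of $V$. Let $P := \{ p \in V^* \mid \forall x \in V,\ \langle p, x\rangle \leq q(x) \}$. A function $f : V \to \mathbb{R}$ is nonexpansive with respect to $q$ if, and only if, $$f(x) = \min_{y \in V} \; \max_{p \in P} \; \left\{ \langle p, x-y\rangle + f(y) \right\} \quad \text{for all } x \in V .$$ Moreover, the value of the latter expression does not change if the maximum is restricted to the points $p \in \overline{\operatorname{ext} P}$.
   Context: $V$ is a real topological vector space (not assumed Hausdorff or locally convex). $V^*$ denotes the space of all linear forms on $V$ (algebraic dual), and $\langle\cdot,\cdot\rangle$ is the duality product. A weak Minkowski norm on $V$ is a function $q : V \to \mathbb{R}$ that is convex and positively homogeneous, i.e. $q(\lambda x) = \lambda q(x)$ for all $\lambda \geq 0$, $x \in V$ (it need not be symmetric nor nonnegative). A function $f : V \to \mathbb{R}$ is nonexpansive with respect to $q$ if $f(x) - f(y) \leq q(x-y)$ for all $x,y \in V$. $\operatorname{ext} P$ is the set of extreme points of $P$, and $\overline{\operatorname{ext} P}$ its closure in the weak* topology (the topology of pointwise convergence on $V$). Writing $\min$ and $\max$ means that the extrema are attained. *)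

theory Defs
  imports "HOL-Analysis.Analysis" "HOL-Library.Function_Algebras"
begin

text \<open>
  Real topological vector spaces: addition (already in \<^class>\<open>topological_ab_group_add\<close>) and scalar
  multiplication are jointly continuous. Neither a separation axiom nor local convexity is assumed.
\<close>

class real_tvs = real_vector + topological_ab_group_add +
  assumes tendsto_scaleR_Pair:
    "LIM x (nhds (a::real) \<times>\<^sub>F nhds b). fst x *\<^sub>R snd x :> nhds (a *\<^sub>R b)"

text \<open>
  The pointwise vector space structure on functions. It makes \<^const>\<open>extreme_point_of\<close> applicable
  to sets of linear forms, which are represented as functions satisfying \<^term>\<open>linear\<close>.
\<close>

instantiation "fun" :: (type, real_vector) real_vector
begin

definition scaleR_fun :: "real \<Rightarrow> ('a \<Rightarrow> 'b) \<Rightarrow> 'a \<Rightarrow> 'b"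
  where "scaleR_fun r f = (\<lambda>x. r *\<^sub>R f x)"

instance
  by standard (simp_all add: scaleR_fun_def plus_fun_def fun_eq_iff algebra_simps)

end

definition weak_minkowski_norm :: "('v::real_vector \<Rightarrow> real) \<Rightarrow> bool" where
  "weak_minkowski_norm q \<longleftrightarrow>
     convex_on UNIV q \<and> (\<forall>c\<ge>0. \<forall>x. q (c *\<^sub>R x) = c * q x)"

definition nonexpansive :: "('v::real_vector \<Rightarrow> real) \<Rightarrow> ('v \<Rightarrow> real) \<Rightarrow> bool" where
  "nonexpansive q f \<longleftrightarrow> (\<forall>x y. f x - f y \<le> q (x - y))"

definition algebraic_dual :: "('v::real_vector \<Rightarrow> real) set" where
  "algebraic_dual = {p. linear p}"

text \<open>
  The library topology on a function type is the product topology, i.e. that of pointwise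
  convergence; the weak* topology is the one it induces on the algebraic dual.
\<close>

definition weak_star_topology :: "('v::real_vector \<Rightarrow> real) topology" where
  "weak_star_topology = top_of_set algebraic_dual"

definition dual_ball :: "('v::real_vector \<Rightarrow> real) \<Rightarrow> ('v \<Rightarrow> real) set" where
  "dual_ball q = {p \<in> algebraic_dual. \<forall>x. p x \<le> q x}"

definition ext :: "'a::real_vector set \<Rightarrow> 'a set" where
  "ext S = {x. x extreme_point_of S}"

definition is_max_value :: "('a \<Rightarrow> real) \<Rightarrow> 'a set \<Rightarrow> real \<Rightarrow> bool" where
  "is_max_value g A m \<longleftrightarrow> m \<in> g ` A \<and> (\<forall>a\<in>A. g a \<le> m)"

definition is_min_value :: "('a \<Rightarrow> real) \<Rightarrow> 'a set \<Rightarrow> real \<Rightarrow> bool" where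
  "is_min_value g A m \<longleftrightarrow> m \<in> g ` A \<and> (\<forall>a\<in>A. m \<le> g a)"

text \<open>
  \<open>is_min_max_value h A B v\<close> says that \<open>v\<close> is the minimum over \<open>a\<close> in \<open>A\<close> of the maximum over
  \<open>b\<close> in \<open>B\<close> of \<open>h a b\<close>, where the outer minimum and the inner maximum for every \<open>a\<close> in \<open>A\<close>
  are attained.
\<close>

definition is_min_max_value ::
    "('a \<Rightarrow> 'b \<Rightarrow> real) \<Rightarrow> 'a set \<Rightarrow> 'b set \<Rightarrow> real \<Rightarrow> bool" where
  "is_min_max_value h A B v \<longleftrightarrow>
     (\<exists>M. (\<forall>a\<in>A. is_max_value (h a) B (M a)) \<and> is_min_value M A v)"

end

theory Submission
  imports Defs
begin

text \<open>
  Everything reduces to the fact that, for every \<open>z\<close>, the evaluation \<open>p \<mapsto> p z\<close> attains the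
  maximum \<open>q z\<close> on the dual ball, and does so at an extreme point. Given this, the inner maximum is
  \<open>q (x - y) + f y\<close>, whether it runs over the dual ball or over any subset that contains its
  extreme points. The formula for \<open>f\<close> then says that \<open>f x \<le> q (x - y) + f y\<close> for all \<open>y\<close>, which is
  nonexpansiveness, with equality at \<open>y = x\<close> because \<open>q 0 = 0\<close>. The weak* closure of the extreme
  points is such a subset, because the dual ball is weak* closed.

  The extreme maximizer is built inside the ordered set of weak Minkowski norms, where a face of
  the dual ball is represented by its support function. Passing to the subface that maximizes the
  evaluation at \<open>x\<close> replaces the norm \<open>r\<close> by its directional derivative at \<open>x\<close>
  (\<open>tilt\<close>). By Zorn's lemma there is a minimal norm among those that bound a face on which
  the evaluation at \<open>z\<close> equals \<open>q z\<close>. By minimality it agrees with all its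
  tilts, hence it is linear, and a face bounded by a linear form is a single extreme point. The
  argument covers the Hahn-Banach theorem and the existence of extreme points in one stroke:
  chains are handled by pointwise infima, so that compactness of the dual ball never enters.
\<close>

section \<open>Weak Minkowski norms as sublinear functions\<close>

lemma weak_minkowski_norm_zero:
  assumes "weak_minkowski_norm q"
  shows "q 0 = 0"
proof -
  have "q (0 *\<^sub>R 0) = 0 * q 0"
    using assms unfolding weak_minkowski_norm_def by blast
  then show ?thesis by simp
qed

lemma weak_minkowski_norm_scaleR:
  assumes "weak_minkowski_norm q" "0 \<le> c"
  shows "q (c *\<^sub>R x) = c * q x"
  using assms unfolding weak_minkowski_norm_def by blast

lemma weak_minkowski_norm_add:
  assumes q: "weak_minkowski_norm q"
  shows "q (x + y) \<le> q x + q y"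
proof -
  have "convex_on UNIV q"
    using q unfolding weak_minkowski_norm_def by blast
  then have "q ((1/2) *\<^sub>R x + (1/2) *\<^sub>R y) \<le> (1/2) * q x + (1/2) * q y"
    unfolding convex_on_def by (metis UNIV_I field_sum_of_halves zero_le_divide_1_iff zero_le_numeral)
  moreover have "q ((1/2) *\<^sub>R x + (1/2) *\<^sub>R y) = (1/2) * q (x + y)"
    using weak_minkowski_norm_scaleR[OF q, of "1/2" "x + y"] by (simp add: scaleR_add_right)
  ultimately show ?thesis by simp
qed

lemma weak_minkowski_norm_minus_lower:
  assumes "weak_minkowski_norm q"
  shows "- q (- x) \<le> q x"
  using weak_minkowski_norm_add[OF assms, of x "- x"] weak_minkowski_norm_zero[OF assms] by simp

text \<open>
  Only one inequality is asked for in the homogeneity condition: the other follows by rescaling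
  with \<open>1 / c\<close>. This suits functions defined as infima, for which upper bounds are immediate.
\<close>

lemma weak_minkowski_normI:
  assumes zero: "q 0 = 0"
    and scale: "\<And>c x. 0 < c \<Longrightarrow> q (c *\<^sub>R x) \<le> c * q x"
    and add: "\<And>x y. q (x + y) \<le> q x + q y"
  shows "weak_minkowski_norm q"
proof -
  have hom: "q (c *\<^sub>R x) = c * q x" if "0 \<le> c" for c x
  proof (cases "c = 0")
    case True
    then show ?thesis by (simp add: zero)
  next
    case False
    with that have c: "0 < c" by simp
    have "q x \<le> (1 / c) * q (c *\<^sub>R x)"
      using scale[of "1 / c" "c *\<^sub>R x"] c by simp
    then have "c * q x \<le> q (c *\<^sub>R x)"
      using c by (simp add: field_simps)
    with scale[OF c] show ?thesis by (simp add: antisym)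
  qed
  have "convex_on UNIV q"
  proof (rule convex_onI)
    fix t x y
    assume "0 < (t::real)" "t < 1"
    then show "q ((1 - t) *\<^sub>R x + t *\<^sub>R y) \<le> (1 - t) * q x + t * q y"
      using add[of "(1 - t) *\<^sub>R x" "t *\<^sub>R y"] by (simp add: hom)
  qed simp
  with hom show ?thesis unfolding weak_minkowski_norm_def by blast
qed

lemma weak_minkowski_norm_linear:
  assumes q: "weak_minkowski_norm q" and odd: "\<And>x. q (- x) = - q x"
  shows "linear q"
proof (rule linearI)
  fix x y
  have "q ((x + y) + (- y)) \<le> q (x + y) + q (- y)"
    by (rule weak_minkowski_norm_add[OF q])
  then have "q x + q y \<le> q (x + y)"
    by (simp add: odd)
  with weak_minkowski_norm_add[OF q, of x y] show "q (x + y) = q x + q y" by simp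
next
  fix c x
  show "q (c *\<^sub>R x) = c *\<^sub>R q x"
  proof (cases "0 \<le> c")
    case True
    then show ?thesis by (simp add: weak_minkowski_norm_scaleR[OF q])
  next
    case False
    then have "q ((- c) *\<^sub>R x) = - c * q x"
      by (simp only: weak_minkowski_norm_scaleR[OF q])
    then show ?thesis using odd[of "c *\<^sub>R x"] by simp
  qed
qed

text \<open>
  Comparability of the members is what makes the infimum subadditive: bounds at \<open>x\<close> and at \<open>y\<close> that
  come from two different members are both improved by the smaller one.
\<close>

lemma weak_minkowski_norm_INF_chain:
  fixes C :: "('v::real_vector \<Rightarrow> real) set"
  assumes ne: "C \<noteq> {}" and C: "\<And>r. r \<in> C \<Longrightarrow> weak_minkowski_norm r"
    and chain: "\<And>r s. r \<in> C \<Longrightarrow> s \<in> C \<Longrightarrow> r \<le> s \<or> s \<le> r"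
    and bdd: "\<And>x. bdd_below ((\<lambda>r. r x) ` C)"
  shows "weak_minkowski_norm (\<lambda>x. INF r\<in>C. r x)" (is "weak_minkowski_norm ?u")
proof (rule weak_minkowski_normI)
  have lower: "?u x \<le> r x" if "r \<in> C" for r x
    using bdd that by (rule cINF_lower)
  show "?u 0 = 0"
    using ne by (simp add: weak_minkowski_norm_zero[OF C] cong: INF_cong)
  show "?u (c *\<^sub>R x) \<le> c * ?u x" if c: "0 < c" for c x
  proof -
    have "?u (c *\<^sub>R x) / c \<le> ?u x"
    proof (rule cINF_greatest[OF ne])
      fix r assume r: "r \<in> C"
      have "?u (c *\<^sub>R x) \<le> c * r x"
        using lower[OF r, of "c *\<^sub>R x"] c by (simp add: weak_minkowski_norm_scaleR[OF C[OF r]])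
      then show "?u (c *\<^sub>R x) / c \<le> r x"
        using c by (simp add: field_simps)
    qed
    then show ?thesis using c by (simp add: field_simps)
  qed
  fix x y
  have split: "?u (x + y) \<le> r x + s y" if rs: "r \<in> C" "s \<in> C" for r s
  proof -
    obtain m where m: "m \<in> C" "m x \<le> r x" "m y \<le> s y"
      using chain[OF rs] rs by (auto simp: le_fun_def)
    have "?u (x + y) \<le> m x + m y"
      using lower[OF m(1)] weak_minkowski_norm_add[OF C[OF m(1)]] by (rule order_trans)
    with m show ?thesis by linarith
  qed
  have "?u (x + y) - ?u y \<le> ?u x"
  proof (rule cINF_greatest[OF ne])
    fix r assume r: "r \<in> C"
    have "?u (x + y) - r x \<le> ?u y"
      using split[OF r] by (intro cINF_greatest[OF ne]) (simp add: algebra_simps)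
    then show "?u (x + y) - ?u y \<le> r x" by linarith
  qed
  then show "?u (x + y) \<le> ?u x + ?u y" by linarith
qed

section \<open>The directional derivative\<close>

text \<open>
  The difference quotients of \<open>r\<close> at \<open>x\<close> in direction \<open>v\<close> decrease to the one-sided directional
  derivative. By homogeneity the quotient for step \<open>1 / t\<close> is \<open>r (v + t *\<^sub>R x) - t * r x\<close>; this form
  makes sense for \<open>t = 0\<close> as well, where it gives \<open>r v\<close>. The linear forms below \<open>tilt r x\<close>
  are those forms \<open>p\<close> below \<open>r\<close> that satisfy \<open>p x = r x\<close>.
\<close>

definition tilt :: "('v::real_vector \<Rightarrow> real) \<Rightarrow> 'v \<Rightarrow> 'v \<Rightarrow> real" where
  "tilt r x v = (INF t\<in>{0..}. r (v + t *\<^sub>R x) - t * r x)"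

lemma tilt_lower:
  assumes r: "weak_minkowski_norm r" and "0 \<le> t"
  shows "tilt r x v \<le> r (v + t *\<^sub>R x) - t * r x"
  unfolding tilt_def
proof (rule cINF_lower)
  have "- r (- v) \<le> r (v + s *\<^sub>R x) - s * r x" if "0 \<le> s" for s
    using weak_minkowski_norm_add[OF r, of "v + s *\<^sub>R x" "- v"]
    by (simp add: weak_minkowski_norm_scaleR[OF r that])
  then show "bdd_below ((\<lambda>t. r (v + t *\<^sub>R x) - t * r x) ` {0..})"
    by (intro bdd_belowI2) simp
qed (use assms in simp)

lemma tilt_greatest:
  assumes "\<And>t. 0 \<le> t \<Longrightarrow> m \<le> r (v + t *\<^sub>R x) - t * r x"
  shows "m \<le> tilt r x v"
  unfolding tilt_def using assms by (intro cINF_greatest) auto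

lemma tilt_le:
  assumes "weak_minkowski_norm r"
  shows "tilt r x \<le> r"
  using tilt_lower[OF assms order_refl] by (simp add: le_fun_def)

lemma tilt_minus_direction:
  assumes "weak_minkowski_norm r"
  shows "tilt r x (- x) \<le> - r x"
  using tilt_lower[OF assms zero_le_one, of x "- x"] weak_minkowski_norm_zero[OF assms] by simp

lemma weak_minkowski_norm_tilt:
  assumes r: "weak_minkowski_norm r"
  shows "weak_minkowski_norm (tilt r x)"
proof (rule weak_minkowski_normI)
  have "(\<lambda>t. r (0 + t *\<^sub>R x) - t * r x) ` {0..} = {0}"
    by (auto simp: weak_minkowski_norm_scaleR[OF r] image_iff)
  then show "tilt r x 0 = 0"
    by (simp only: tilt_def cInf_singleton)
  show "tilt r x (c *\<^sub>R v) \<le> c * tilt r x v" if c: "0 < c" for c v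
  proof -
    have "tilt r x (c *\<^sub>R v) / c \<le> tilt r x v"
    proof (rule tilt_greatest)
      fix t :: real assume t: "0 \<le> t"
      have "r (c *\<^sub>R v + (c * t) *\<^sub>R x) = c * r (v + t *\<^sub>R x)"
        using weak_minkowski_norm_scaleR[OF r, of c "v + t *\<^sub>R x"] c
        by (simp add: scaleR_add_right)
      with tilt_lower[OF r, of "c * t" x "c *\<^sub>R v"] c t
      have "tilt r x (c *\<^sub>R v) \<le> c * (r (v + t *\<^sub>R x) - t * r x)"
        by (simp add: algebra_simps)
      then show "tilt r x (c *\<^sub>R v) / c \<le> r (v + t *\<^sub>R x) - t * r x"
        using c by (simp add: field_simps)
    qed
    then show ?thesis using c by (simp add: field_simps)
  qed
  fix v w
  have split: "tilt r x (v + w) \<le> (r (v + s *\<^sub>R x) - s * r x) + (r (w + t *\<^sub>R x) - t * r x)"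
    if "0 \<le> s" "0 \<le> t" for s t
  proof -
    have "tilt r x (v + w) \<le> r ((v + w) + (s + t) *\<^sub>R x) - (s + t) * r x"
      using that by (intro tilt_lower[OF r]) simp
    moreover have "r ((v + w) + (s + t) *\<^sub>R x) \<le> r (v + s *\<^sub>R x) + r (w + t *\<^sub>R x)"
      using weak_minkowski_norm_add[OF r, of "v + s *\<^sub>R x" "w + t *\<^sub>R x"]
      by (simp add: algebra_simps)
    ultimately show ?thesis by (simp add: algebra_simps)
  qed
  have "tilt r x (v + w) - tilt r x w \<le> tilt r x v"
  proof (rule tilt_greatest)
    fix s :: real assume s: "0 \<le> s"
    have "tilt r x (v + w) - (r (v + s *\<^sub>R x) - s * r x) \<le> tilt r x w"
      using split[OF s] by (intro tilt_greatest) (simp add: algebra_simps)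
    then show "tilt r x (v + w) - tilt r x w \<le> r (v + s *\<^sub>R x) - s * r x" by linarith
  qed
  then show "tilt r x (v + w) \<le> tilt r x v + tilt r x w" by linarith
qed

section \<open>Faces of the dual ball and their support functions\<close>

lemma dual_ball_iff: "p \<in> dual_ball q \<longleftrightarrow> linear p \<and> p \<le> q"
  by (simp add: dual_ball_def algebraic_dual_def le_fun_def)

text \<open>
  The set of linear forms below \<open>r\<close> is required to be a face of \<open>dual_ball q\<close>: a form in the
  relative interior of a segment can lie in it only if both endpoints do.
\<close>

definition bounds_face :: "('v::real_vector \<Rightarrow> real) \<Rightarrow> ('v \<Rightarrow> real) \<Rightarrow> bool" where
  "bounds_face q r \<longleftrightarrow>
     (\<forall>a\<in>dual_ball q. \<forall>b\<in>dual_ball q. \<forall>t. 0 < t \<longrightarrow> t < 1 \<longrightarrow>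
        (1 - t) *\<^sub>R a + t *\<^sub>R b \<le> r \<longrightarrow> a \<le> r \<and> b \<le> r)"

lemma bounds_face_self: "bounds_face q q"
  by (simp add: bounds_face_def dual_ball_iff)

lemma bounds_faceD:
  assumes "bounds_face q r" "a \<in> dual_ball q" "b \<in> dual_ball q" "0 < t" "t < 1"
    "(1 - t) *\<^sub>R a + t *\<^sub>R b \<le> r"
  shows "a \<le> r" "b \<le> r"
  using assms unfolding bounds_face_def by blast+

lemma le_tiltI:
  assumes p: "linear p" "p \<le> r" and x: "r x \<le> p x"
  shows "p \<le> tilt r x"
  unfolding le_fun_def
proof (intro allI tilt_greatest)
  fix v and t :: real assume t: "0 \<le> t"
  have "p v + t * p x = p (v + t *\<^sub>R x)"
    using p(1) by (simp add: linear_add linear_scale)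
  also have "\<dots> \<le> r (v + t *\<^sub>R x)"
    using p(2) by (simp add: le_fun_def)
  finally show "p v \<le> r (v + t *\<^sub>R x) - t * r x"
    using mult_left_mono[OF x t] by linarith
qed

text \<open>
  A face of a face is a face: a convex combination of two numbers that are at most \<open>r x\<close> can reach
  \<open>r x\<close> only if both numbers equal it.
\<close>

lemma bounds_face_tilt:
  assumes r: "weak_minkowski_norm r" and face: "bounds_face q r"
  shows "bounds_face q (tilt r x)"
  unfolding bounds_face_def
proof (intro ballI allI impI)
  fix a b and t :: real
  assume ab: "a \<in> dual_ball q" "b \<in> dual_ball q" and t: "0 < t" "t < 1"
    and le: "(1 - t) *\<^sub>R a + t *\<^sub>R b \<le> tilt r x"
  have lin: "linear a" "linear b"
    using ab by (auto simp: dual_ball_iff)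
  have below: "a \<le> r" "b \<le> r"
    using bounds_faceD[OF face ab t order_trans[OF le tilt_le[OF r]]] by auto
  have "(1 - t) * a (- x) + t * b (- x) \<le> tilt r x (- x)"
    using le by (auto simp: le_fun_def plus_fun_def scaleR_fun_def)
  also have "\<dots> \<le> - r x"
    by (rule tilt_minus_direction[OF r])
  finally have comb: "r x \<le> (1 - t) * a x + t * b x"
    using lin by (simp add: linear_neg)
  have ax: "a x \<le> r x" and bx: "b x \<le> r x"
    using below by (auto simp: le_fun_def)
  have "t * b x \<le> t * r x" "(1 - t) * a x \<le> (1 - t) * r x"
    using ax bx t by (simp_all add: mult_left_mono)
  with comb have "(1 - t) * r x \<le> (1 - t) * a x" "t * r x \<le> t * b x"
    by (simp_all add: algebra_simps)
  with t have "r x \<le> a x" "r x \<le> b x"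
    by simp_all
  with lin below show "a \<le> tilt r x \<and> b \<le> tilt r x"
    by (simp add: le_tiltI)
qed

lemma bounds_face_INF:
  assumes ne: "C \<noteq> {}" and C: "\<And>r. r \<in> C \<Longrightarrow> bounds_face q r"
    and bdd: "\<And>x. bdd_below ((\<lambda>r. r x) ` C)"
  shows "bounds_face q (\<lambda>x. INF r\<in>C. r x)"
proof -
  have below: "p \<le> (\<lambda>x. INF r\<in>C. r x) \<longleftrightarrow> (\<forall>r\<in>C. p \<le> r)" for p
    using le_cINF_iff[OF ne bdd] by (auto simp: le_fun_def)
  show ?thesis
    unfolding bounds_face_def below using C bounds_faceD by blast
qed

lemma linear_le_linear_imp_eq:
  fixes p r :: "'v::real_vector \<Rightarrow> real"
  assumes "linear p" "linear r" "p \<le> r"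
  shows "p = r"
proof
  fix x
  have "p x \<le> r x" "p (- x) \<le> r (- x)"
    using assms(3) by (auto simp: le_fun_def)
  then show "p x = r x"
    using assms(1,2) by (simp add: linear_neg)
qed

text \<open>
  A linear form has no other linear form below it, so the face that it bounds is a singleton.
\<close>

lemma linear_bounds_face_imp_ext:
  assumes "linear r" "r \<le> q" and face: "bounds_face q r"
  shows "r \<in> ext (dual_ball q)"
proof -
  have "r \<notin> open_segment a b" if ab: "a \<in> dual_ball q" "b \<in> dual_ball q" for a b
  proof
    assume "r \<in> open_segment a b"
    then obtain t where "a \<noteq> b" and t: "0 < t" "t < 1" and eq: "r = (1 - t) *\<^sub>R a + t *\<^sub>R b"
      by (auto simp: in_segment)
    have "a \<le> r" "b \<le> r"
      using bounds_faceD[OF face ab t] eq by auto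
    then have "a = r" "b = r"
      using ab assms(1) linear_le_linear_imp_eq unfolding dual_ball_iff by blast+
    with \<open>a \<noteq> b\<close> show False by simp
  qed
  with assms show ?thesis
    by (simp add: ext_def extreme_point_of_def dual_ball_iff)
qed

section \<open>Evaluations are maximized at extreme points\<close>

text \<open>
  For a weak Minkowski norm \<open>r \<le> q\<close> the condition \<open>r (- z) \<le> - q z\<close> forces \<open>p z = q z\<close>
  for each linear form \<open>p \<le> r\<close>, and it is inherited by smaller norms. A minimal norm \<open>r\<close> with this
  property that bounds a face equals \<open>tilt r x\<close> for each \<open>x\<close>; hence \<open>r (- x) \<le> - r x\<close>, so that \<open>r\<close> is odd.
\<close>

theorem exists_ext_dual_ball_maximizer:
  assumes q: "weak_minkowski_norm q"
  shows "\<exists>p\<in>ext (dual_ball q). p z = q z"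
proof -
  define A where
    "A = {r. weak_minkowski_norm r \<and> r \<le> q \<and> bounds_face q r \<and> r (- z) \<le> - q z}"
  have po: "partial_order_on A (relation_of (\<ge>) A)"
    by (rule partial_order_on_relation_ofI) auto
  have "\<exists>u\<in>A. \<forall>r\<in>C. r \<ge> u" if chain: "C \<in> Chains (relation_of (\<ge>) A)" for C
  proof (cases "C = {}")
    case True
    have "tilt q z \<in> A"
      using q by (simp add: A_def weak_minkowski_norm_tilt tilt_le bounds_face_tilt
          bounds_face_self tilt_minus_direction)
    with True show ?thesis by blast
  next
    case ne: False
    have sub: "C \<subseteq> A" and comparable: "\<And>r s. r \<in> C \<Longrightarrow> s \<in> C \<Longrightarrow> r \<le> s \<or> s \<le> r"
      using chain by (auto simp: Chains_def relation_of_def)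
    have bdd: "bdd_below ((\<lambda>r. r x) ` C)" for x
    proof (rule bdd_belowI2)
      fix r assume "r \<in> C"
      with sub have "weak_minkowski_norm r" "r (- x) \<le> q (- x)"
        by (auto simp: A_def le_fun_def)
      with weak_minkowski_norm_minus_lower[of r x] show "- q (- x) \<le> r x"
        by linarith
    qed
    define u where "u = (\<lambda>x. INF r\<in>C. r x)"
    have lower: "u \<le> r" if "r \<in> C" for r
      unfolding u_def using bdd that by (intro le_funI cINF_lower)
    obtain r where r: "r \<in> C" using ne by blast
    then have "u \<le> q" "u (- z) \<le> - q z"
      using sub lower[OF r] by (auto simp: A_def le_fun_def intro: order_trans)
    moreover have "weak_minkowski_norm u" "bounds_face q u"
      unfolding u_def using sub ne comparable bdd
      by (auto simp: A_def intro!: weak_minkowski_norm_INF_chain bounds_face_INF)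
    ultimately have "u \<in> A" by (simp add: A_def)
    with lower show ?thesis by blast
  qed
  from predicate_Zorn[OF po this]
  obtain r where rA: "r \<in> A" and min: "\<And>s. s \<in> A \<Longrightarrow> s \<le> r \<Longrightarrow> s = r"
    by auto
  have r: "weak_minkowski_norm r" "r \<le> q" "bounds_face q r" "r (- z) \<le> - q z"
    using rA by (auto simp: A_def)
  have "tilt r x = r" for x
  proof (rule min)
    have le: "tilt r x \<le> r" using r(1) by (rule tilt_le)
    then have "tilt r x (- z) \<le> r (- z)" by (simp add: le_fun_def)
    with r le show "tilt r x \<in> A"
      by (auto simp: A_def weak_minkowski_norm_tilt bounds_face_tilt)
    show "tilt r x \<le> r" by (rule le)
  qed
  then have "r (- x) = - r x" for x
    using tilt_minus_direction[OF r(1), of x] weak_minkowski_norm_minus_lower[OF r(1), of x]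
    by simp
  with r(1) have lin: "linear r" by (rule weak_minkowski_norm_linear)
  then have "q z \<le> r z"
    using r(4) by (simp add: linear_neg)
  moreover have "r z \<le> q z"
    using r(2) by (simp add: le_fun_def)
  ultimately have "r z = q z" by simp
  with linear_bounds_face_imp_ext[OF lin r(2,3)] show ?thesis by blast
qed

lemma is_max_value_eval:
  assumes "weak_minkowski_norm q" "ext (dual_ball q) \<subseteq> B" "B \<subseteq> dual_ball q"
  shows "is_max_value (\<lambda>p. p z) B (q z)"
proof -
  obtain p where "p \<in> ext (dual_ball q)" "p z = q z"
    using exists_ext_dual_ball_maximizer[OF assms(1)] by blast
  with assms(2) have "q z \<in> (\<lambda>p. p z) ` B"
    by (metis image_eqI subsetD)
  with assms(3) show ?thesis
    by (auto simp: is_max_value_def dual_ball_def)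
qed

lemma ext_subset: "ext S \<subseteq> S"
  by (auto simp: ext_def extreme_point_of_def)

lemma closedin_weak_star_dual_ball: "closedin weak_star_topology (dual_ball q)"
proof -
  have "closed {p. p x \<le> q x}" for x
    by (intro closed_Collect_le continuous_intros) auto
  then have "closed (\<Inter>x. {p. p x \<le> q x})"
    by blast
  moreover have "dual_ball q = algebraic_dual \<inter> (\<Inter>x. {p. p x \<le> q x})"
    by (auto simp: dual_ball_def)
  ultimately show ?thesis
    by (simp only: weak_star_topology_def closedin_closed_Int)
qed

lemma weak_star_closure_ext_dual_ball:
  shows "ext (dual_ball q) \<subseteq> weak_star_topology closure_of ext (dual_ball q)"
    and "weak_star_topology closure_of ext (dual_ball q) \<subseteq> dual_ball q"
proof -
  have "ext (dual_ball q) \<subseteq> topspace weak_star_topology"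
    using ext_subset[of "dual_ball q"] by (auto simp: weak_star_topology_def dual_ball_def)
  then show "ext (dual_ball q) \<subseteq> weak_star_topology closure_of ext (dual_ball q)"
    by (rule closure_of_subset)
  show "weak_star_topology closure_of ext (dual_ball q) \<subseteq> dual_ball q"
    using ext_subset closedin_weak_star_dual_ball by (rule closure_of_minimal)
qed

section \<open>The min-max formula\<close>

lemma is_max_value_unique:
  "is_max_value g A m \<Longrightarrow> is_max_value g A n \<Longrightarrow> m = n"
  unfolding is_max_value_def by (blast intro: order_antisym)

lemma is_min_max_value_iff:
  assumes "\<And>a. a \<in> A \<Longrightarrow> is_max_value (h a) B (M a)"
  shows "is_min_max_value h A B v \<longleftrightarrow> is_min_value M A v"
proof
  assume "is_min_max_value h A B v"
  then obtain N where N: "\<And>a. a \<in> A \<Longrightarrow> is_max_value (h a) B (N a)" and v: "is_min_value N A v"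
    unfolding is_min_max_value_def by blast
  have "N a = M a" if "a \<in> A" for a
    using N[OF that] assms[OF that] by (rule is_max_value_unique)
  with v show "is_min_value M A v"
    by (auto simp: is_min_value_def)
next
  assume "is_min_value M A v"
  with assms show "is_min_max_value h A B v"
    unfolding is_min_max_value_def by blast
qed

lemma is_min_max_value_eval_iff:
  assumes "weak_minkowski_norm q" "ext (dual_ball q) \<subseteq> B" "B \<subseteq> dual_ball q"
  shows "is_min_max_value (\<lambda>y p. p (x - y) + f y) UNIV B v
    \<longleftrightarrow> is_min_value (\<lambda>y. q (x - y) + f y) UNIV v"
proof (rule is_min_max_value_iff)
  fix y
  show "is_max_value (\<lambda>p. p (x - y) + f y) B (q (x - y) + f y)"
    using is_max_value_eval[OF assms, of "x - y"] by (auto simp: is_max_value_def image_iff)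
qed

lemma nonexpansive_iff_is_min_value:
  assumes "weak_minkowski_norm q"
  shows "nonexpansive q f \<longleftrightarrow> (\<forall>x. is_min_value (\<lambda>y. q (x - y) + f y) UNIV (f x))"
proof -
  have "f x \<in> range (\<lambda>y. q (x - y) + f y)" for x
    by (rule range_eqI[of _ _ x]) (simp add: weak_minkowski_norm_zero[OF assms])
  then show ?thesis
    by (simp add: nonexpansive_def is_min_value_def algebra_simps)
qed

theorem theorem3p4:
  fixes q f :: "'v::real_tvs \<Rightarrow> real"
  assumes "weak_minkowski_norm q" and "continuous_on UNIV q"
  shows "(nonexpansive q f \<longleftrightarrow>
            (\<forall>x. is_min_max_value (\<lambda>y p. p (x - y) + f y) UNIV (dual_ball q) (f x)))
       \<and> (\<forall>x v. is_min_max_value (\<lambda>y p. p (x - y) + f y) UNIV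
                  (weak_star_topology closure_of ext (dual_ball q)) v
              \<longleftrightarrow> is_min_max_value (\<lambda>y p. p (x - y) + f y) UNIV (dual_ball q) v)"
  using nonexpansive_iff_is_min_value[OF assms(1)]
    is_min_max_value_eval_iff[OF assms(1) ext_subset order_refl]
    is_min_max_value_eval_iff[OF assms(1) weak_star_closure_ext_dual_ball]
  by simp

end
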